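(* Let $n\ge 4$ be an integer and $K_n$ the complete graph on $n$ vertices. (i) If $n$ is even and $v\in V(K_n)$, then the inequality $$x(\delta(\{v\}))-x(E(K_n-v))\le \frac{n-2}{2}$$ defines a facet of $\mathrm{TECSP}(K_n)$. (ii) If $n$ is odd, $v\in V(K_n)$, $h=\{w_1,w_2\}\in E(K_n-v)$, and $f:=\{v,w_1\}$, then the inequality $$x(\delta(\{v\})\setminus\{f\})-x(E(K_n-v)\setminus\{h\})-x_f\le\frac{n-3}{2}$$ defines a facet of $\mathrm{TECSP}(K_n)$.
   Context: All graphs are finite, simple and undirected. $\delta(\{v\})$ is the set of edges incident to $v$; $K_n-v$ is the graph obtained by deleting vertex $v$ and its incident edges. A graph is $2$-edge-connected if it is connected and has no bridges (edges whose removal increases the number of connected components); the empty graph and a single vertex are $2$-edge-connected. For $F\subseteq E$, $x(F)=\sum_{e\in F}x_e$. $\chi^H$ is the incidence vector of $E(H)$ in $\{0,1\}^{E(K_n)}$, and $\mathrm{TECSP}(K_n)=\mathrm{conv}\{\chi^H : H\subseteq K_n\text{ is }2\text{-edge-connected}\}\subseteq\mathbb{R}^{E(K_n)}$. A facet is a face of dimension $\dim(\mathrm{TECSP}(K_n))-1$. *)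

theory Defs
  imports "HOL-Analysis.Analysis" "HOL-Library.Function_Algebras"
begin

text \<open>Pointwise real vector space structure on real-valued functions, so that
  edge-indexed vectors x :: nat set \<Rightarrow> real live in a real vector space
  (convex hulls and affine dependence are the library notions).\<close>

instantiation "fun" :: (type, real_vector) real_vector
begin
definition scaleR_fun :: "real \<Rightarrow> ('a \<Rightarrow> 'b) \<Rightarrow> 'a \<Rightarrow> 'b"
  where "scaleR_fun c f = (\<lambda>x. c *\<^sub>R f x)"
instance
  by standard (auto simp: scaleR_fun_def fun_eq_iff scaleR_add_right scaleR_add_left)
end

text \<open>Vertices of K_n are 0..n-1; edges are 2-element vertex sets.\<close>

definition Kn_edges :: "nat \<Rightarrow> nat set set" where
  "Kn_edges n = {{a, b} | a b. a < n \<and> b < n \<and> a \<noteq> b}"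

text \<open>Graph (V, F): F a set of 2-element subsets of V.\<close>

definition is_graph :: "nat set \<Rightarrow> nat set set \<Rightarrow> bool" where
  "is_graph V F \<longleftrightarrow> (\<forall>e\<in>F. \<exists>a b. e = {a, b} \<and> a \<noteq> b \<and> a \<in> V \<and> b \<in> V)"

definition adj :: "nat set set \<Rightarrow> (nat \<times> nat) set" where
  "adj F = {(a, b). {a, b} \<in> F \<and> a \<noteq> b}"

definition graph_connected :: "nat set \<Rightarrow> nat set set \<Rightarrow> bool" where
  "graph_connected V F \<longleftrightarrow> (\<forall>u\<in>V. \<forall>w\<in>V. (u, w) \<in> (adj F)\<^sup>*)"

text \<open>2-edge-connected: connected and no bridge (for a connected graph an edge is a
  bridge iff its deletion disconnects the graph). Empty graph and single vertex qualify.\<close>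

definition two_edge_connected :: "nat set \<Rightarrow> nat set set \<Rightarrow> bool" where
  "two_edge_connected V F \<longleftrightarrow> is_graph V F \<and> graph_connected V F \<and>
      (\<forall>e\<in>F. graph_connected V (F - {e}))"

definition incidence_vec :: "nat set set \<Rightarrow> nat set \<Rightarrow> real" where
  "incidence_vec F = indicator F"

definition TECSP :: "nat \<Rightarrow> (nat set \<Rightarrow> real) set" where
  "TECSP n = convex hull {incidence_vec F | V F.
      V \<subseteq> {..<n} \<and> F \<subseteq> Kn_edges n \<and> two_edge_connected V F}"

text \<open>Dimension of a set = (maximum number of affinely independent points) - 1.\<close>

definition affdim :: "(nat set \<Rightarrow> real) set \<Rightarrow> int" where
  "affdim S = int (Max {card T | T. T \<subseteq> S \<and> finite T \<and> \<not> affine_dependent T}) - 1"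

definition xsum :: "(nat set \<Rightarrow> real) \<Rightarrow> nat set set \<Rightarrow> real" where
  "xsum x F = (\<Sum>e\<in>F. x e)"

text \<open>The inequality a(x) <= b defines a facet of P: it is valid for P and the face
  {x in P. a(x) = b} has dimension dim P - 1.\<close>

definition defines_facet ::
  "(nat set \<Rightarrow> real) set \<Rightarrow> ((nat set \<Rightarrow> real) \<Rightarrow> real) \<Rightarrow> real \<Rightarrow> bool" where
  "defines_facet P a b \<longleftrightarrow> (\<forall>x\<in>P. a x \<le> b) \<and>
      affdim {x \<in> P. a x = b} = affdim P - 1"

end

theory Submission
  imports Defs
begin

text \<open>Validity: if \<open>v\<close> lies in a 2-edge-connected graph \<open>H\<close>, then \<open>H - v\<close> has at least
  \<open>|V(H - v)| - |E(H - v)|\<close> components, and each of them contains at least two neighbours of \<open>v\<close>.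
  The number \<open>r\<close> of components thus satisfies \<open>deg v - |E(H - v)| \<le> r \<le> (deg v) / 2\<close>, and parity
  of \<open>n\<close> rounds this down to the right-hand side.

  Dimension: the right-hand side is positive while the polytope contains 0, so it suffices that the
  tight incidence vectors span the whole edge space linearly. The tight graphs used are windmills
  (triangles glued at \<open>v\<close>) with one extra block glued at \<open>v\<close>. For even \<open>n\<close> the block is a
  triangle or a diamond; differences give \<open>x_{vc} + x_{bc}\<close>, and a windmill alone then gives
  \<open>x_{vc}\<close>. For odd \<open>n\<close>, deleting \<open>w1\<close> reduces to the even case, and the edges at \<open>w1\<close> come from a
  triangle \<open>v w1 w2\<close>, a 4-cycle \<open>v w2 w1 x\<close> and two such 4-cycles sharing the path \<open>v w2 w1\<close>.\<close>

section \<open>Facets from spanning sets of tight vertices\<close>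

text \<open>The bound on every affinely independent \<open>U\<close> makes the set of cardinalities
  finite, which \<open>Max\<close> needs in order to be meaningful; \<open>T\<close> attains the
  bound.\<close>

lemma affdim_eqI:
  assumes "T \<subseteq> S" "finite T" "\<not> affine_dependent T"
    and "\<And>U. U \<subseteq> S \<Longrightarrow> finite U \<Longrightarrow> \<not> affine_dependent U \<Longrightarrow> card U \<le> card T"
  shows "affdim S = int (card T) - 1"
proof -
  let ?C = "{card T | T. T \<subseteq> S \<and> finite T \<and> \<not> affine_dependent T}"
  have "finite ?C"
    by (rule finite_subset[of _ "{..card T}"]) (use assms(4) in auto)
  then have "Max ?C = card T"
    by (rule Max_eqI) (use assms in auto)
  then show ?thesis
    by (simp add: affdim_def)
qed

section \<open>Affine versus linear independence\<close>

lemma independent_imp_not_affine_dependent_insert_0: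
  fixes B :: "'a::real_vector set"
  assumes "independent B"
  shows "\<not> affine_dependent (insert 0 B)"
proof -
  have "0 \<notin> B"
    using assms dependent_zero by blast
  then show ?thesis
    using assms by (simp add: affine_dependent_iff_dependent)
qed

text \<open>Translation by one point of \<open>T\<close> turns the remaining points into linearly
  independent vectors of \<open>span B\<close>; the extra 1 accounts for the chosen point.\<close>

lemma card_le_of_affine_independent:
  fixes T :: "'a::real_vector set"
  assumes "finite T" "\<not> affine_dependent T" "T \<subseteq> span B" "finite B"
  shows "card T \<le> card B + 1"
proof (cases "T = {}")
  case False
  then obtain a where a: "a \<in> T" by blast
  define U where "U = (\<lambda>x. x - a) ` (T - {a})"
  have "\<not> affine_dependent (insert a (T - {a}))"
    using assms a by (simp add: insert_absorb)
  then have "independent U"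
    by (subst (asm) affine_dependent_iff_dependent) (auto simp: U_def image_def Setcompr_eq_image)
  moreover have "U \<subseteq> span B"
    using assms a by (auto simp: U_def intro!: span_diff)
  ultimately have "card U \<le> card B"
    using independent_span_bound[OF assms(4)] by blast
  moreover have "card U = card T - 1"
    unfolding U_def using a assms by (subst card_image) (auto simp: inj_on_def)
  ultimately show ?thesis by simp
qed simp

text \<open>Off the hyperplane through the origin, affine and linear independence agree.\<close>

lemma independent_of_affine_independent:
  fixes T :: "'a::real_vector set" and a :: "'a \<Rightarrow> real"
  assumes "linear a" "\<And>x. x \<in> T \<Longrightarrow> a x = b" "b \<noteq> 0" "\<not> affine_dependent T"
  shows "independent T"
proof
  assume "dependent T"
  then obtain U u where U: "finite U" "U \<subseteq> T" "(\<Sum>x\<in>U. u x *\<^sub>R x) = 0" "\<exists>x\<in>U. u x \<noteq> 0"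
    unfolding dependent_explicit by blast
  \<comment> \<open>Applying \<open>a\<close> to the linear relation yields a multiple of
    \<open>b\<close>. Since \<open>b\<close> is nonzero, the coefficients add up to 0, and the
    relation is an affine one.\<close>
  have "0 = a (\<Sum>x\<in>U. u x *\<^sub>R x)"
    using U assms(1) by (simp add: linear_0)
  also have "\<dots> = (\<Sum>x\<in>U. u x * a x)"
    using assms(1) by (simp add: linear_sum linear_scale)
  also have "\<dots> = (\<Sum>x\<in>U. u x) * b"
    using U assms(2) by (simp add: sum_distrib_right subset_iff)
  finally have "(\<Sum>x\<in>U. u x) = 0"
    using assms(3) by simp
  then have "affine_dependent T"
    using U unfolding affine_dependent_explicit by blast
  with assms(4) show False ..
qed

section \<open>Incidence vectors and the standard basis of the edge space\<close>

lemma incidence_vec_Un: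
  assumes "A \<inter> B = {}"
  shows "incidence_vec (A \<union> B) = incidence_vec A + incidence_vec B"
  using assms by (auto simp: incidence_vec_def fun_eq_iff indicator_def)

lemma incidence_vec_insert:
  assumes "e \<notin> B"
  shows "incidence_vec (insert e B) = incidence_vec {e} + incidence_vec B"
  using incidence_vec_Un[of "{e}" B] assms by simp

lemma incidence_vec_empty: "incidence_vec {} = 0"
  by (auto simp: incidence_vec_def fun_eq_iff)

lemma incidence_vec_in_subspace:
  assumes "subspace L" "finite F" "\<And>e. e \<in> F \<Longrightarrow> incidence_vec {e} \<in> L"
  shows "incidence_vec F \<in> L"
  using assms(2,3)
proof (induction F)
  case empty
  show ?case unfolding incidence_vec_empty by (rule subspace_0[OF assms(1)])
next
  case (insert e F)
  then show ?case
    using assms(1) by (subst incidence_vec_insert) (auto intro: subspace_add)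
qed

text \<open>Strips from a tight graph the edges whose unit vectors are already known to lie in
  \<open>L\<close>: their sum is subtracted from the vector of \<open>G\<close>.\<close>

lemma incidence_vec_subset_in_subspace:
  assumes "subspace L" "incidence_vec G \<in> L" "finite G" "X \<subseteq> G"
    "\<And>e. e \<in> G - X \<Longrightarrow> incidence_vec {e} \<in> L"
  shows "incidence_vec X \<in> L"
proof -
  have "incidence_vec (G - X) \<in> L"
    by (rule incidence_vec_in_subspace[OF assms(1) finite_Diff[OF assms(3)] assms(5)])
  moreover have "incidence_vec G = incidence_vec X + incidence_vec (G - X)"
    using assms(4) by (subst incidence_vec_Un[symmetric]) (auto simp: Un_absorb1)
  ultimately show ?thesis
    using assms(1,2) subspace_diff by fastforce
qed

lemma inj_incidence_vec: "inj incidence_vec"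
proof (rule injI)
  fix A B assume "incidence_vec A = incidence_vec B"
  then show "A = B"
    unfolding incidence_vec_def by (metis indicator_eq_1_iff subsetI subset_antisym)
qed

lemma finite_Kn_edges: "finite (Kn_edges n)"
  by (rule finite_subset[of _ "Pow {..<n}"]) (auto simp: Kn_edges_def)

lemma sum_fun_apply: "(\<Sum>x\<in>A. f x) y = (\<Sum>x\<in>A. f x y)"
  for f :: "'a \<Rightarrow> 'b \<Rightarrow> real"
  by (induction A rule: infinite_finite_induct) auto

lemma supported_in_span:
  assumes "finite E" "\<And>e. e \<notin> E \<Longrightarrow> x e = 0"
  shows "x \<in> span ((\<lambda>e. incidence_vec {e}) ` E)"
proof -
  have "x = (\<Sum>e\<in>E. x e *\<^sub>R incidence_vec {e})"
  proof
    fix e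
    have "(\<Sum>d\<in>E. x d *\<^sub>R incidence_vec {d}) e = (\<Sum>d\<in>E. if d = e then x d else 0)"
      unfolding sum_fun_apply
      by (intro sum.cong) (auto simp: scaleR_fun_def incidence_vec_def indicator_def)
    also have "\<dots> = x e"
      using assms by (simp add: sum.delta')
    finally show "x e = (\<Sum>e\<in>E. x e *\<^sub>R incidence_vec {e}) e" ..
  qed
  also have "\<dots> \<in> span ((\<lambda>e. incidence_vec {e}) ` E)"
    by (intro span_sum span_scale span_base) auto
  finally show ?thesis .
qed

lemma independent_unit_vecs:
  assumes "finite E"
  shows "independent ((\<lambda>e. incidence_vec {e}) ` E)"
proof -
  have inj: "inj_on (\<lambda>e. incidence_vec {e}) E"
    using inj_incidence_vec by (auto simp: inj_on_def dest: injD)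
  show ?thesis
  proof (rule independent_if_scalars_zero)
    show "finite ((\<lambda>e. incidence_vec {e}) ` E)" using assms by simp
  next
    fix f and x :: "nat set \<Rightarrow> real"
    assume 0: "(\<Sum>x\<in>(\<lambda>e. incidence_vec {e}) ` E. f x *\<^sub>R x) = 0"
      and "x \<in> (\<lambda>e. incidence_vec {e}) ` E"
    then obtain e where e: "e \<in> E" "x = incidence_vec {e}" by blast
    have "0 = (\<Sum>d\<in>E. f (incidence_vec {d}) *\<^sub>R incidence_vec {d}) e"
      using 0 inj by (simp add: sum.reindex)
    also have "\<dots> = (\<Sum>d\<in>E. if d = e then f x else 0)"
      unfolding sum_fun_apply
      by (intro sum.cong) (auto simp: scaleR_fun_def incidence_vec_def indicator_def e)
    also have "\<dots> = f x"
      using assms e by simp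
    finally show "f x = 0" ..
  qed
qed

lemma linear_weighted_sum:
  "linear (\<lambda>x :: nat set \<Rightarrow> real. \<Sum>e\<in>E. w e * x e)"
  by (rule linearI) (auto simp: scaleR_fun_def algebra_simps sum.distrib sum_distrib_left)

lemma weighted_sum_incidence_vec:
  assumes "finite E" "F \<subseteq> E"
  shows "(\<Sum>e\<in>E. w e * incidence_vec F e) = sum w F"
proof -
  have "(\<Sum>e\<in>E. w e * incidence_vec F e) = (\<Sum>e\<in>E. if e \<in> F then w e else 0)"
    by (intro sum.cong) (auto simp: incidence_vec_def)
  also have "\<dots> = sum w F"
    using assms by (simp add: sum.If_cases Int_absorb1)
  finally show ?thesis .
qed

text \<open>A basis \<open>B\<close> chosen among the tight vectors has as many elements as there
  are edges. Together with 0 it is a largest affinely independent subset of the polytope; alone it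
  is one of the face. The two dimensions therefore differ by exactly 1.\<close>

lemma facet_criterion:
  fixes w :: "nat set \<Rightarrow> real"
  assumes b: "b > 0"
    and valid: "\<And>V F. V \<subseteq> {..<n} \<Longrightarrow> F \<subseteq> Kn_edges n \<Longrightarrow> two_edge_connected V F \<Longrightarrow> sum w F \<le> b"
    and spanning: "\<And>e. e \<in> Kn_edges n \<Longrightarrow> incidence_vec {e} \<in>
      span {incidence_vec F | V F. V \<subseteq> {..<n} \<and> F \<subseteq> Kn_edges n \<and> two_edge_connected V F \<and> sum w F = b}"
  shows "defines_facet (TECSP n) (\<lambda>x. \<Sum>e\<in>Kn_edges n. w e * x e) b"
proof -
  let ?E = "Kn_edges n"
  let ?U = "(\<lambda>e. incidence_vec {e}) ` ?E"
  let ?a = "\<lambda>x. \<Sum>e\<in>?E. w e * x e"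
  let ?G = "{incidence_vec F | V F. V \<subseteq> {..<n} \<and> F \<subseteq> ?E \<and> two_edge_connected V F}"
  let ?S = "{incidence_vec F | V F. V \<subseteq> {..<n} \<and> F \<subseteq> ?E \<and> two_edge_connected V F \<and> sum w F = b}"
  let ?face = "{x \<in> TECSP n. ?a x = b}"
  note finE = finite_Kn_edges[of n]
  note lin = linear_weighted_sum[of w ?E]
  have cardU: "card ?U = card ?E"
    using inj_incidence_vec by (intro card_image) (auto simp: inj_on_def dest: injD)
  have GU: "?G \<subseteq> span ?U"
    by (auto intro!: supported_in_span finE) (auto simp: incidence_vec_def indicator_def)
  then have PU: "TECSP n \<subseteq> span ?U"
    unfolding TECSP_def by (intro hull_minimal) (auto simp: subspace_imp_convex)
  have aS: "?a x = b" if "x \<in> ?S" for x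
    using that finE by (auto simp: weighted_sum_incidence_vec)
  have SP: "?S \<subseteq> ?face"
    using aS unfolding TECSP_def by (auto intro!: hull_inc)
  have valid_P: "?a x \<le> b" if "x \<in> TECSP n" for x
  proof -
    have "convex {x. ?a x \<le> b}"
      using convex_linear_vimage[OF lin convex_real_interval(2)[of b]]
      by (simp add: vimage_def atMost_def)
    then have "TECSP n \<subseteq> {x. ?a x \<le> b}"
      unfolding TECSP_def using finE valid
      by (intro hull_minimal) (auto simp: weighted_sum_incidence_vec)
    with that show ?thesis by blast
  qed
  obtain B where B: "B \<subseteq> ?S" "independent B" "?S \<subseteq> span B"
    by (rule maximal_independent_subset[of ?S])
  have "?face \<subseteq> TECSP n" by blast
  then have BP: "B \<subseteq> TECSP n"
    using B(1) SP by (meson order_trans)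
  then have BU: "B \<subseteq> span ?U"
    using PU by (rule order_trans)
  have Bfin: "finite B" "card B \<le> card ?U"
    using independent_span_bound[OF _ B(2) BU] finE by auto
  have "?U \<subseteq> span ?S"
    using spanning by auto
  also have "\<dots> \<subseteq> span B"
    using B(3) by (simp add: span_minimal)
  finally have "card ?U \<le> card B"
    using independent_span_bound[OF Bfin(1) independent_unit_vecs[OF finE]] by blast
  with Bfin cardU have cardB: "card B = card ?E" by simp
  have B0: "\<not> affine_dependent (insert 0 B)"
    using B(2) by (rule independent_imp_not_affine_dependent_insert_0)
  then have Baff: "\<not> affine_dependent B"
    using affine_dependent_subset by blast
  have "0 \<notin> B"
    using B(2) dependent_zero by blast
  then have card0: "card (insert 0 B) = card ?E + 1"
    using Bfin cardB by simp
  have "affdim (TECSP n) = int (card (insert 0 B)) - 1"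
  proof (rule affdim_eqI)
    \<comment> \<open>The origin is the incidence vector of the empty graph, so it is a point of the
      polytope.\<close>
    have "two_edge_connected {} {}"
      by (simp add: two_edge_connected_def is_graph_def graph_connected_def)
    then have "0 \<in> ?G"
      unfolding incidence_vec_empty[symmetric] by blast
    then have "0 \<in> TECSP n"
      unfolding TECSP_def by (rule hull_inc)
    then show "insert 0 B \<subseteq> TECSP n"
      using BP by simp
    fix T assume T: "T \<subseteq> TECSP n" "finite T" "\<not> affine_dependent T"
    then have "card T \<le> card ?U + 1"
      using PU finE by (intro card_le_of_affine_independent) auto
    then show "card T \<le> card (insert 0 B)"
      using card0 cardU by simp
  qed (use Bfin B0 in auto)
  moreover have "affdim ?face = int (card B) - 1"
  proof (rule affdim_eqI)
    fix T assume T: "T \<subseteq> ?face" "finite T" "\<not> affine_dependent T"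
    \<comment> \<open>As \<open>b > 0\<close>, the face misses the origin, so its affinely
      independent subsets are linearly independent. This saves one point compared with the bound for
      the polytope.\<close>
    then have "independent T"
      using lin b by (intro independent_of_affine_independent[of ?a T b]) auto
    moreover have "T \<subseteq> span ?U"
      using T PU by auto
    ultimately have "card T \<le> card ?U"
      using independent_span_bound[of ?U T] finE by auto
    then show "card T \<le> card B"
      using cardU cardB by simp
  qed (use B SP Bfin Baff in auto)
  ultimately show ?thesis
    using valid_P card0 cardB by (simp add: defines_facet_def)
qed

section \<open>2-edge-connected graphs\<close>

lemma adj_mono: "F \<subseteq> G \<Longrightarrow> adj F \<subseteq> adj G"
  by (auto simp: adj_def)

lemma sym_adj: "sym (adj F)"
  by (auto simp: adj_def sym_def insert_commute)

lemma rtrancl_adj_sym: "(a, b) \<in> (adj F)\<^sup>* \<Longrightarrow> (b, a) \<in> (adj F)\<^sup>*"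
  using sym_adj sym_rtrancl symD by metis

lemma graph_connectedI:
  assumes "\<And>u. u \<in> V \<Longrightarrow> (u, v) \<in> (adj F)\<^sup>*"
  shows "graph_connected V F"
  using assms rtrancl_adj_sym rtrancl_trans unfolding graph_connected_def by metis

text \<open>Merges the two connectivity clauses into one: deleting a set outside \<open>F\<close>
  changes nothing, and \<open>{}\<close> is never an edge, so \<open>e = {}\<close> recovers the
  connectivity of \<open>F\<close> itself.\<close>

lemma two_edge_connected_iff:
  "two_edge_connected V F \<longleftrightarrow> is_graph V F \<and> (\<forall>e. graph_connected V (F - {e}))"
proof -
  have "graph_connected V (F - {e})" if "graph_connected V F" "e \<notin> F" for e
    using that by simp
  moreover have "{} \<notin> F" if "is_graph V F"
    using that by (auto simp: is_graph_def)
  ultimately show ?thesis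
    unfolding two_edge_connected_def by (metis Diff_empty Diff_insert0)
qed

lemma is_graph_iff: "is_graph V F \<longleftrightarrow> (\<forall>e\<in>F. card e = 2 \<and> e \<subseteq> V)"
proof -
  have "(\<exists>a b. e = {a, b} \<and> a \<noteq> b \<and> a \<in> V \<and> b \<in> V) \<longleftrightarrow> card e = 2 \<and> e \<subseteq> V" for e
    by (subst card_2_iff) (auto; blast)
  then show ?thesis
    by (simp add: is_graph_def)
qed

lemma is_graph_Un: "is_graph V F \<Longrightarrow> is_graph V' F' \<Longrightarrow> is_graph (V \<union> V') (F \<union> F')"
  by (auto simp: is_graph_iff)

lemma is_graphE:
  assumes "is_graph V F" "e \<in> F"
  obtains a b where "e = {a, b}" "a \<noteq> b" "a \<in> V" "b \<in> V"
  using assms unfolding is_graph_def by blast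

lemma is_graph_doubletonD:
  assumes "is_graph V F" "{a, b} \<in> F"
  shows "a \<noteq> b" "a \<in> V" "b \<in> V"
  using assms by (auto simp: is_graph_iff card_2_iff doubleton_eq_iff)

text \<open>After the deletion of any one edge, both graphs still connect their vertices to the
  common vertex \<open>v\<close>. The graphs may share edges, as happens for the diamond and for the
  two 4-cycles with a common path.\<close>

lemma two_edge_connected_Un:
  assumes "two_edge_connected V F" "two_edge_connected V' F'" "v \<in> V" "v \<in> V'"
  shows "two_edge_connected (V \<union> V') (F \<union> F')"
proof -
  have "(u, v) \<in> (adj (F \<union> F' - {e}))\<^sup>*" if "u \<in> V \<union> V'" for u e
  proof -
    have "(u, v) \<in> (adj (F - {e}))\<^sup>* \<or> (u, v) \<in> (adj (F' - {e}))\<^sup>*"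
      using that assms by (auto simp: two_edge_connected_iff graph_connected_def)
    moreover have "adj (F - {e}) \<subseteq> adj (F \<union> F' - {e})" "adj (F' - {e}) \<subseteq> adj (F \<union> F' - {e})"
      by (auto intro!: adj_mono)
    ultimately show ?thesis
      using rtrancl_mono by blast
  qed
  moreover have "is_graph (V \<union> V') (F \<union> F')"
    using assms by (simp add: two_edge_connected_iff is_graph_Un)
  ultimately show ?thesis
    by (auto simp: two_edge_connected_iff intro: graph_connectedI)
qed

text \<open>A single edge lies on at most one of two edge-disjoint paths, so the other one survives
  its deletion.\<close>

lemma rtrancl_adj_two_paths:
  assumes "(u, v) \<in> (adj F1)\<^sup>*" "(u, v) \<in> (adj F2)\<^sup>*" "F1 \<inter> F2 = {}" "F1 \<union> F2 \<subseteq> F"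
  shows "(u, v) \<in> (adj (F - {e}))\<^sup>*"
proof -
  have "F1 \<subseteq> F - {e} \<or> F2 \<subseteq> F - {e}"
    using assms(3,4) by blast
  then show ?thesis
    using assms(1,2) rtrancl_mono[OF adj_mono[of F1 "F - {e}"]]
      rtrancl_mono[OF adj_mono[of F2 "F - {e}"]] by blast
qed

lemma two_edge_connected_singleton: "two_edge_connected {v} {}"
  by (auto simp: two_edge_connected_def is_graph_def graph_connected_def)

lemma adj_path:
  shows "a \<noteq> b \<Longrightarrow> (a, b) \<in> (adj {{a, b}})\<^sup>*"
    and "a \<noteq> b \<Longrightarrow> b \<noteq> c \<Longrightarrow> (a, c) \<in> (adj {{a, b}, {b, c}})\<^sup>*"
    and "a \<noteq> b \<Longrightarrow> b \<noteq> c \<Longrightarrow> c \<noteq> d \<Longrightarrow> (a, d) \<in> (adj {{a, b}, {b, c}, {c, d}})\<^sup>*"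
proof -
  have step: "(x, y) \<in> (adj F)\<^sup>*" if "{x, y} \<in> F" "x \<noteq> y" for x y F
    using that by (auto simp: adj_def)
  show "a \<noteq> b \<Longrightarrow> (a, b) \<in> (adj {{a, b}})\<^sup>*"
    by (rule step) auto
  show "a \<noteq> b \<Longrightarrow> b \<noteq> c \<Longrightarrow> (a, c) \<in> (adj {{a, b}, {b, c}})\<^sup>*"
    by (rule rtrancl_trans[OF step step]) auto
  show "a \<noteq> b \<Longrightarrow> b \<noteq> c \<Longrightarrow> c \<noteq> d \<Longrightarrow> (a, d) \<in> (adj {{a, b}, {b, c}, {c, d}})\<^sup>*"
    by (rule rtrancl_trans[OF rtrancl_trans[OF step step] step]) auto
qed

lemma two_edge_connected_triangle:
  assumes "distinct [v, a, b]"
  shows "two_edge_connected {v, a, b} {{v, a}, {v, b}, {a, b}}" (is "two_edge_connected ?V ?F")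
proof -
  have "(u, v) \<in> (adj (?F - {e}))\<^sup>*" if "u \<in> ?V" for u e
  proof -
    have "(a, v) \<in> (adj (?F - {e}))\<^sup>*"
      using assms by (intro rtrancl_adj_two_paths[OF adj_path(1)[of a v] adj_path(2)[of a b v]])
        (auto simp: doubleton_eq_iff)
    moreover have "(b, v) \<in> (adj (?F - {e}))\<^sup>*"
      using assms by (intro rtrancl_adj_two_paths[OF adj_path(1)[of b v] adj_path(2)[of b a v]])
        (auto simp: doubleton_eq_iff)
    ultimately show ?thesis using that by auto
  qed
  moreover have "is_graph ?V ?F"
    using assms by (auto simp: is_graph_def)
  ultimately show ?thesis
    unfolding two_edge_connected_iff by (blast intro: graph_connectedI)
qed

lemma two_edge_connected_square:
  assumes "distinct [v, a, c, b]"
  shows "two_edge_connected {v, a, b, c} {{v, a}, {v, b}, {c, a}, {c, b}}"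
    (is "two_edge_connected ?V ?F")
proof -
  have ne: "v \<noteq> a" "v \<noteq> b" "v \<noteq> c" "a \<noteq> b" "a \<noteq> c" "b \<noteq> c"
    "a \<noteq> v" "b \<noteq> v" "c \<noteq> v" "b \<noteq> a" "c \<noteq> a" "c \<noteq> b"
    using assms by auto
  have "(u, v) \<in> (adj (?F - {e}))\<^sup>*" if "u \<in> ?V" for u e
  proof -
    have "(a, v) \<in> (adj (?F - {e}))\<^sup>*"
      by (rule rtrancl_adj_two_paths[OF adj_path(1)[of a v] adj_path(3)[of a c b v]])
        (simp_all add: ne doubleton_eq_iff)
    moreover have "(b, v) \<in> (adj (?F - {e}))\<^sup>*"
      by (rule rtrancl_adj_two_paths[OF adj_path(1)[of b v] adj_path(3)[of b c a v]])
        (simp_all add: ne doubleton_eq_iff)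
    moreover have "(c, v) \<in> (adj (?F - {e}))\<^sup>*"
      by (rule rtrancl_adj_two_paths[OF adj_path(2)[of c a v] adj_path(2)[of c b v]])
        (simp_all add: ne doubleton_eq_iff)
    ultimately show ?thesis using that by auto
  qed
  moreover have "is_graph ?V ?F"
    using ne unfolding is_graph_def by blast
  ultimately show ?thesis
    unfolding two_edge_connected_iff by (blast intro: graph_connectedI)
qed

lemma is_graph_finite:
  assumes "is_graph V F" "finite V"
  shows "finite F"
  by (rule finite_subset[of _ "Pow V"]) (use assms in \<open>auto simp: is_graph_iff\<close>)

lemma Kn_edges_eq: "Kn_edges n = {e. card e = 2 \<and> e \<subseteq> {..<n}}"
proof -
  have "e \<in> Kn_edges n \<longleftrightarrow> card e = 2 \<and> e \<subseteq> {..<n}" for e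
    unfolding Kn_edges_def card_2_iff by auto
  then show ?thesis by blast
qed

lemma is_graph_subset_Kn_edges: "is_graph V F \<Longrightarrow> V \<subseteq> {..<n} \<Longrightarrow> F \<subseteq> Kn_edges n"
  by (auto simp: is_graph_iff Kn_edges_eq)

section \<open>Counting the components of \<open>H - v\<close>\<close>

text \<open>Each added edge merges at most two components, so at least
  \<open>card N - card F\<close> components remain. \<open>R\<close> holds representatives of
  distinct components, which avoids handling components as sets.\<close>

lemma exists_disconnected_vertices:
  assumes "finite F" "finite N" "is_graph N F"
  shows "\<exists>R\<subseteq>N. (\<forall>r\<in>R. \<forall>s\<in>R. (r, s) \<in> (adj F)\<^sup>* \<longrightarrow> r = s) \<and> card N \<le> card R + card F"
  using assms(1,3)
proof (induction F)
  case empty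
  have "adj {} = {}" by (simp add: adj_def)
  then show ?case by (intro exI[of _ N]) auto
next
  case (insert e F)
  then have "is_graph N F" by (simp add: is_graph_def)
  with insert obtain R where R: "R \<subseteq> N" "\<forall>r\<in>R. \<forall>s\<in>R. (r, s) \<in> (adj F)\<^sup>* \<longrightarrow> r = s"
    "card N \<le> card R + card F" by blast
  obtain a b where e: "e = {a, b}"
    using insert.prems by (auto simp: is_graph_def)
  \<comment> \<open>The new edge may merge the components of \<open>a\<close> and \<open>b\<close>;
    the representative of the component of \<open>a\<close>, if there is one, is given up.\<close>
  define R' where "R' = R - {r. (r, a) \<in> (adj F)\<^sup>*}"
  \<comment> \<open>If \<open>r\<close> cannot reach \<open>a\<close> within \<open>F\<close>, a
    walk from \<open>r\<close> first crosses the new edge from \<open>b\<close> to \<open>a\<close>,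
    and crossing back only returns to \<open>b\<close>, which \<open>r\<close> reaches anyway. In
    the second alternative \<open>y\<close> lies in the component of \<open>a\<close>, which
    contains no element of \<open>R'\<close>.\<close>
  have path: "(r, y) \<in> (adj F)\<^sup>* \<or> ((r, b) \<in> (adj F)\<^sup>* \<and> (a, y) \<in> (adj F)\<^sup>*)"
    if "(r, y) \<in> (adj (insert e F))\<^sup>*" "(r, a) \<notin> (adj F)\<^sup>*" for r y
    using that(1)
  proof (induction rule: rtrancl_induct)
    case (step y z)
    from step.hyps(2) consider "(y, z) \<in> adj F" | "y = a" "z = b" | "y = b" "z = a"
      by (auto simp: adj_def e doubleton_eq_iff)
    then show ?case
    proof cases
      case 1
      then show ?thesis using step.IH by (meson rtrancl.rtrancl_into_rtrancl)
    next
      case 2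
      then show ?thesis using step.IH that(2) by auto
    next
      case 3
      then show ?thesis
        using step.IH that(2) by auto
    qed
  qed simp
  have "\<forall>r\<in>R'. \<forall>s\<in>R'. (r, s) \<in> (adj (insert e F))\<^sup>* \<longrightarrow> r = s"
    using path R(2) rtrancl_adj_sym unfolding R'_def by blast
  moreover have "card R \<le> card R' + 1"
  proof -
    have "is_singleton (R \<inter> {r. (r, a) \<in> (adj F)\<^sup>*}) \<or> R \<inter> {r. (r, a) \<in> (adj F)\<^sup>*} = {}"
    proof -
      have "r = s" if "r \<in> R \<inter> {r. (r, a) \<in> (adj F)\<^sup>*}" "s \<in> R \<inter> {r. (r, a) \<in> (adj F)\<^sup>*}" for r s
        using that R(2) rtrancl_adj_sym rtrancl_trans by (metis IntD1 IntD2 mem_Collect_eq)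
      then show ?thesis by (metis all_not_in_conv is_singletonI')
    qed
    then have "card (R \<inter> {r. (r, a) \<in> (adj F)\<^sup>*}) \<le> 1"
      by (auto simp: is_singleton_altdef)
    moreover have "finite R" using R assms(2) finite_subset by blast
    ultimately show ?thesis
      unfolding R'_def by (metis add.commute add_le_cancel_left card_Int_Diff add_mono order_refl)
  qed
  ultimately show ?case
    using R insert.hyps by (intro exI[of _ R']) (auto simp: R'_def)
qed

text \<open>On a walk from \<open>r\<close> to \<open>v\<close>, the vertex just before the first
  visit to \<open>v\<close> is a neighbour of \<open>v\<close>, and the walk up to it uses no edge
  at \<open>v\<close>.\<close>

lemma reach_neighbour:
  assumes "(r, v) \<in> (adj G)\<^sup>*" "r \<noteq> v"
  shows "\<exists>u. u \<noteq> v \<and> {v, u} \<in> G \<and> (r, u) \<in> (adj {e \<in> G. v \<notin> e})\<^sup>*"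
  using assms
proof (induction rule: converse_rtrancl_induct)
  case (step r y)
  show ?case
  proof (cases "y = v")
    case True
    then show ?thesis using step by (auto simp: adj_def insert_commute)
  next
    case False
    then have "(r, y) \<in> adj {e \<in> G. v \<notin> e}"
      using step by (auto simp: adj_def)
    then show ?thesis
      using step False by (meson converse_rtrancl_into_rtrancl)
  qed
qed simp

definition neighbours :: "nat set set \<Rightarrow> nat \<Rightarrow> nat set" where
  "neighbours F v = {u. u \<noteq> v \<and> {v, u} \<in> F}"

lemma neighbours_subset:
  assumes "is_graph V F"
  shows "neighbours F v \<subseteq> V - {v}"
  using is_graph_doubletonD[OF assms] by (auto simp: neighbours_def)

text \<open>Each component of \<open>H - v\<close> contains two neighbours of \<open>v\<close>, as \<open>v\<close> is not joined to it by a
  bridge; \<open>r\<close> stands for the number of components.\<close>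

lemma two_edge_connected_count:
  assumes H: "two_edge_connected V F" and "finite V" "v \<in> V"
  obtains r where "2 * r \<le> card (neighbours F v)"
    "card (V - {v}) \<le> r + card {e \<in> F. v \<notin> e}"
proof -
  let ?F = "{e \<in> F. v \<notin> e}"
  have graph: "is_graph V F"
    using H by (simp add: two_edge_connected_iff)
  then have "is_graph (V - {v}) ?F"
    by (auto simp: is_graph_iff)
  then obtain R where R: "R \<subseteq> V - {v}" "\<forall>r\<in>R. \<forall>s\<in>R. (r, s) \<in> (adj ?F)\<^sup>* \<longrightarrow> r = s"
    "card (V - {v}) \<le> card R + card ?F"
    using exists_disconnected_vertices[of ?F "V - {v}"] is_graph_finite[OF graph] assms(2) by auto
  have finR: "finite R" using R assms finite_subset by blast
  have finD: "finite (neighbours F v)"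
    using neighbours_subset[OF graph] assms(2) finite_subset by blast
  define P where "P r = {u \<in> neighbours F v. (r, u) \<in> (adj ?F)\<^sup>*}" for r
  have finP: "finite (P r)" for r using finD by (simp add: P_def)
  have "2 \<le> card (P r)" if "r \<in> R" for r
  proof -
    have r: "r \<noteq> v" "(r, v) \<in> (adj (F - {e}))\<^sup>*" for e
      using that R(1) H assms(3) by (auto simp: two_edge_connected_iff graph_connected_def)
    have mono: "(adj {e' \<in> F - {e}. v \<notin> e'})\<^sup>* \<subseteq> (adj ?F)\<^sup>*" for e
      by (intro rtrancl_mono adj_mono) auto
    \<comment> \<open>\<open>{}\<close> is no edge, so deleting it leaves \<open>F\<close> as it is
      and gives a first neighbour of \<open>v\<close>.\<close>
    obtain u1 where u1: "u1 \<in> P r"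
      using reach_neighbour[OF r(2)[of "{}"] r(1)] mono by (auto simp: P_def neighbours_def)
    \<comment> \<open>With the edge to \<open>u1\<close> deleted, the walk to \<open>v\<close> must
      enter through a different neighbour.\<close>
    obtain u2 where u2: "u2 \<in> P r" "u2 \<noteq> u1"
      using reach_neighbour[OF r(2)[of "{v, u1}"] r(1)] mono by (auto simp: P_def neighbours_def)
    have "card {u1, u2} \<le> card (P r)"
      using u1 u2 finP by (intro card_mono) auto
    with u2 show ?thesis by simp
  qed
  then have "2 * card R \<le> (\<Sum>r\<in>R. card (P r))"
    using sum_mono[of R "\<lambda>_. 2" "\<lambda>r. card (P r)"] by (simp add: mult.commute)
  also have "\<dots> = card (\<Union>r\<in>R. P r)"
  proof (rule card_UN_disjoint[symmetric])
    show "\<forall>i\<in>R. \<forall>j\<in>R. i \<noteq> j \<longrightarrow> P i \<inter> P j = {}"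
    proof (intro ballI impI)
      fix r s assume rs: "r \<in> R" "s \<in> R" "r \<noteq> s"
      have "(r, s) \<in> (adj ?F)\<^sup>*" if "u \<in> P r" "u \<in> P s" for u
        using that rtrancl_trans[of r u "adj ?F" s] rtrancl_adj_sym[of s u ?F] by (simp add: P_def)
      then show "P r \<inter> P s = {}"
        using rs R(2) by blast
    qed
  qed (use finR finP in auto)
  also have "\<dots> \<le> card (neighbours F v)"
    using finD by (intro card_mono) (auto simp: P_def)
  finally show ?thesis using that R(3) by blast
qed

section \<open>Tight graphs and facets\<close>

text \<open>Coefficient vector of the inequality for even \<open>n\<close>.\<close>

definition star_weight :: "nat \<Rightarrow> nat set \<Rightarrow> real" where
  "star_weight v e = (if v \<in> e then 1 else - 1)"

lemma sum_star_weight: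
  assumes "is_graph V F" "finite F"
  shows "sum (star_weight v) F = real (card (neighbours F v)) - real (card {e \<in> F. v \<notin> e})"
proof -
  have "{e \<in> F. v \<in> e} = (\<lambda>u. {v, u}) ` neighbours F v"
  proof (intro subset_antisym subsetI)
    fix e assume e: "e \<in> {e \<in> F. v \<in> e}"
    then obtain a b where ab: "e = {a, b}" "a \<noteq> b"
      using is_graphE[OF assms(1)] by blast
    with e have "e = {v, if a = v then b else a}" "(if a = v then b else a) \<noteq> v"
      by auto
    with e show "e \<in> (\<lambda>u. {v, u}) ` neighbours F v"
      unfolding neighbours_def by blast
  qed (auto simp: neighbours_def)
  moreover have "inj_on (\<lambda>u. {v, u}) (neighbours F v)"
    by (auto simp: inj_on_def doubleton_eq_iff)
  ultimately have "card {e \<in> F. v \<in> e} = card (neighbours F v)"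
    by (simp add: card_image)
  moreover have "sum (star_weight v) F
      = (\<Sum>e\<in>{e \<in> F. v \<in> e}. 1) - (\<Sum>e\<in>{e \<in> F. v \<notin> e}. 1)"
    unfolding star_weight_def sum.If_cases[OF assms(2)]
    by (simp add: Int_def)
  ultimately show ?thesis by simp
qed

text \<open>Triangles through \<open>v\<close> on the pairs of a perfect matching of \<open>W\<close>.\<close>

inductive windmill :: "nat \<Rightarrow> nat set \<Rightarrow> nat set set \<Rightarrow> bool" for v where
  windmill_empty: "windmill v {} {}"
| windmill_insert: "windmill v (insert a (insert b W)) ({{v, a}, {v, b}, {a, b}} \<union> F)"
    if "windmill v W F" "a \<notin> W" "b \<notin> W" "distinct [v, a, b]"

section \<open>Windmills and gluing of blocks at a vertex\<close>

lemma windmill_exists: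
  assumes "finite W" "v \<notin> W" "even (card W)"
  shows "\<exists>F. windmill v W F"
  using assms
proof (induction W rule: finite_psubset_induct)
  case (psubset W)
  show ?case
  proof (cases "W = {}")
    case True
    then show ?thesis using windmill_empty by blast
  next
    case False
    then obtain a where a: "a \<in> W" by blast
    have "W \<noteq> {a}" using psubset.prems by auto
    then obtain b where b: "b \<in> W" "b \<noteq> a" using a by blast
    define W' where "W' = W - {a, b}"
    have W: "W = insert a (insert b W')" "a \<notin> W'" "b \<notin> W'"
      using a b by (auto simp: W'_def)
    moreover have "finite W'" using psubset.hyps by (simp add: W'_def)
    ultimately have "even (card W')"
      using psubset.prems b by simp
    then obtain F where "windmill v W' F"
      using psubset.IH[of W'] psubset.prems W by auto
    from windmill_insert[OF this, of a b] show ?thesis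
      using W psubset.prems b by auto
  qed
qed

text \<open>A common edge would need two common vertices.\<close>

lemma graph_blocks_disjoint:
  assumes "is_graph Y X" "is_graph U F" "Y \<inter> U \<subseteq> {v}"
  shows "X \<inter> F = {}"
proof (rule ccontr)
  assume "X \<inter> F \<noteq> {}"
  then obtain e where e: "e \<in> X" "e \<in> F" by blast
  then have "e \<subseteq> {v}" "card e = 2"
    using assms unfolding is_graph_iff by blast+
  then show False
    using card_mono[of "{v}" e] by simp
qed

text \<open>The blocks meet only in \<open>v\<close>, so they share no edge and every weight is
  additive. The weight is left arbitrary because the lemma serves both inequalities.\<close>

lemma glue_at_vertex:
  fixes w :: "nat set \<Rightarrow> real"
  assumes "two_edge_connected Y X" "finite Y" "v \<in> Y"
    and "two_edge_connected (insert v W) F" "finite W" "Y \<inter> W = {}"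
  shows "two_edge_connected (Y \<union> W) (X \<union> F)" "X \<inter> F = {}"
    "sum w (X \<union> F) = sum w X + sum w F"
proof -
  have "Y \<union> insert v W = Y \<union> W"
    using assms(3) by blast
  then show "two_edge_connected (Y \<union> W) (X \<union> F)"
    using two_edge_connected_Un[OF assms(1,4,3)] by simp
  have "is_graph Y X" "is_graph (insert v W) F"
    using assms by (simp_all add: two_edge_connected_def)
  moreover from this show "X \<inter> F = {}"
    by (rule graph_blocks_disjoint) (use assms in auto)
  ultimately show "sum w (X \<union> F) = sum w X + sum w F"
    using assms by (intro sum.union_disjoint) (auto dest: is_graph_finite)
qed

lemma sum_star_weight_triangle:
  assumes "distinct [v, a, b]"
  shows "sum (star_weight v) {{v, a}, {v, b}, {a, b}} = 1"
  using assms by (simp add: star_weight_def doubleton_eq_iff)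

text \<open>Each triangle has weight \<open>1 + 1 - 1 = 1\<close>, and there are
  \<open>card W / 2\<close> of them.\<close>

lemma windmill_graph:
  assumes "windmill v W F"
  shows "finite W \<and> v \<notin> W \<and> two_edge_connected (insert v W) F
    \<and> sum (star_weight v) F = real (card W) / 2"
  using assms
proof induction
  case windmill_empty
  then show ?case by (simp add: two_edge_connected_singleton)
next
  case (windmill_insert W F a b)
  have "{v, a, b} \<inter> W = {}"
    using windmill_insert by auto
  note glue = glue_at_vertex[OF two_edge_connected_triangle[OF windmill_insert.hyps(4)] _ _ _ _ this,
      of v F]
  have "{v, a, b} \<union> W = insert v (insert a (insert b W))" by auto
  then show ?case
    using windmill_insert glue(1) glue(3)[of "star_weight v"] sum_star_weight_triangle[OF windmill_insert.hyps(4)]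
    by (auto simp: field_simps)
qed

lemma incidence_vec_triangle:
  assumes "distinct [v, a, b]"
  shows "incidence_vec {{v, a}, {v, b}, {a, b}}
    = incidence_vec {{v, a}} + (incidence_vec {{v, b}} + incidence_vec {{a, b}})"
proof -
  have "{v, a} \<notin> {{v, b}, {a, b}}" "{v, b} \<notin> {{a, b}}"
    using assms by (auto simp: doubleton_eq_iff)
  then show ?thesis
    using incidence_vec_insert by metis
qed

text \<open>Modulo \<open>L\<close> all star edges agree and all other edges are their negatives, so each triangle of
  a windmill contributes one star edge.\<close>

lemma windmill_modulo_subspace:
  assumes "windmill v W F" "subspace L" "W \<subseteq> U"
    and pair: "\<And>b c. b \<in> U \<Longrightarrow> c \<in> U \<Longrightarrow> b \<noteq> c \<Longrightarrow> incidence_vec {{v, c}} + incidence_vec {{b, c}} \<in> L"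
    and star: "\<And>b. b \<in> U \<Longrightarrow> incidence_vec {{v, b}} - s \<in> L"
  shows "incidence_vec F - (real (card W) / 2) *\<^sub>R s \<in> L"
  using assms(1,3)
proof induction
  case windmill_empty
  have "incidence_vec {} - (real (card {}) / 2) *\<^sub>R s = 0"
    by (simp add: incidence_vec_empty)
  then show ?case
    using subspace_0[OF assms(2)] by metis
next
  case (windmill_insert W F a b)
  have ne: "{v, a, b} \<inter> W = {}" and ab: "a \<in> U" "b \<in> U" "a \<noteq> b"
    using windmill_insert windmill_graph[OF windmill_insert.hyps(1)] by auto
  note W = windmill_graph[OF windmill_insert.hyps(1)]
  have "{{v, a}, {v, b}, {a, b}} \<inter> F = {}"
    by (rule glue_at_vertex(2)[OF two_edge_connected_triangle[OF windmill_insert.hyps(4)], of v W])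
      (use W ne in auto)
  then have "incidence_vec ({{v, a}, {v, b}, {a, b}} \<union> F)
      = incidence_vec {{v, a}} + (incidence_vec {{v, b}} + incidence_vec {{a, b}}) + incidence_vec F"
    by (simp only: incidence_vec_Un incidence_vec_triangle[OF windmill_insert.hyps(4)])
  moreover have "real (card (insert a (insert b W))) / 2 = real (card W) / 2 + 1"
    using W windmill_insert.hyps ab(3) by simp
  \<comment> \<open>The triangle is split so that \<open>{v, a}\<close> is compared with
    \<open>s\<close> while \<open>{v, b}\<close> cancels against \<open>{a, b}\<close> modulo
    \<open>L\<close>.\<close>
  ultimately have eq: "incidence_vec ({{v, a}, {v, b}, {a, b}} \<union> F)
        - (real (card (insert a (insert b W))) / 2) *\<^sub>R s
      = (incidence_vec {{v, a}} - s) + (incidence_vec {{v, b}} + incidence_vec {{a, b}})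
        + (incidence_vec F - (real (card W) / 2) *\<^sub>R s)"
    by (simp only: scaleR_add_left scaleR_one) (simp add: algebra_simps)
  have "incidence_vec F - (real (card W) / 2) *\<^sub>R s \<in> L"
    using windmill_insert.IH windmill_insert.prems by blast
  then show ?case
    unfolding eq
    by (rule subspace_add[OF assms(2) subspace_add[OF assms(2) star[OF ab(1)] pair[OF ab]]])
qed

section \<open>Unit vectors from tight windmills and diamonds\<close>

text \<open>The vertex set is kept general so that both parities can use the result: for even
  \<open>n\<close>, \<open>W\<close> consists of all vertices other than \<open>v\<close>; for odd
  \<open>n\<close>, \<open>w1\<close> is left out too. As \<open>card W\<close> is odd, a tight
  windmill misses exactly one vertex of \<open>W\<close>, and this freedom is what the differences
  exploit.\<close>

lemma star_span:
  assumes L: "subspace L" and W: "finite W" "v \<notin> W" "odd (card W)" "3 \<le> card W"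
    and tight: "\<And>V F. two_edge_connected V F \<Longrightarrow> V \<subseteq> insert v W
      \<Longrightarrow> sum (star_weight v) F = (real (card W) - 1) / 2 \<Longrightarrow> incidence_vec F \<in> L"
    and e: "e \<subseteq> insert v W" "card e = 2"
  shows "incidence_vec {e} \<in> L"
proof -
  have pair: "incidence_vec {{v, c}} + incidence_vec {{b, c}} \<in> L"
    if bc: "b \<in> W" "c \<in> W" "b \<noteq> c" for b c
  proof -
    have "\<not> W \<subseteq> {b, c}"
      using W(4) card_mono[of "{b, c}" W] bc by auto
    then obtain a where a: "a \<in> W" "a \<noteq> b" "a \<noteq> c" by blast
    define U where "U = W - {a, b, c}"
    have "card U = card W - 3"
      unfolding U_def using W(1) a bc by (subst card_Diff_subset) auto
    then have U: "finite U" "v \<notin> U" "even (card U)" "real (card U) = real (card W) - 3"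
      using W by (auto simp: U_def)
    then obtain F where "windmill v U F"
      using windmill_exists by blast
    then have F: "two_edge_connected (insert v U) F" "sum (star_weight v) F = real (card U) / 2"
      using windmill_graph by blast+
    have ne: "v \<noteq> a" "v \<noteq> b" "v \<noteq> c" "a \<noteq> b" "a \<noteq> c" "b \<noteq> c"
      "a \<noteq> v" "b \<noteq> v" "c \<noteq> v" "b \<noteq> a" "c \<noteq> a" "c \<noteq> b"
      using a bc W(2) by auto
    \<comment> \<open>Extending the triangle \<open>?X\<close> to the diamond
      \<open>?X \<union> ?X'\<close> adds \<open>{v, c}\<close> of weight 1 and
      \<open>{b, c}\<close> of weight -1. With the same windmill \<open>F\<close> attached both
      graphs are tight, so their difference lies in \<open>L\<close>.\<close>
    let ?X = "{{v, a}, {v, b}, {a, b}}" and ?X' = "{{v, b}, {v, c}, {b, c}}"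
    have X: "two_edge_connected {v, a, b} ?X" and X': "two_edge_connected {v, b, c} ?X'"
      using ne by (simp_all add: two_edge_connected_triangle)
    have XX: "two_edge_connected ({v, a, b} \<union> {v, b, c}) (?X \<union> ?X')"
      by (rule two_edge_connected_Un[OF X X', of v]) auto
    have wX: "sum (star_weight v) ?X = 1"
      by (rule sum_star_weight_triangle) (simp add: ne)
    have eq: "?X \<union> ?X' = ?X \<union> {{v, c}, {b, c}}" by auto
    have disj: "?X \<inter> {{v, c}, {b, c}} = {}" and new: "{v, c} \<notin> {{b, c}}"
      by (simp_all add: doubleton_eq_iff ne)
    have wXX: "sum (star_weight v) (?X \<union> ?X') = 1"
      unfolding eq using disj wX new
      by (subst sum.union_disjoint) (simp_all add: star_weight_def ne)
    have "incidence_vec (?X \<union> F) \<in> L"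
    proof (rule tight)
      have d: "{v, a, b} \<inter> U = {}" using U by (auto simp: U_def)
      note glue = glue_at_vertex[OF X _ _ F(1) U(1) d]
      show "two_edge_connected ({v, a, b} \<union> U) (?X \<union> F)"
        by (rule glue(1)) auto
      show "sum (star_weight v) (?X \<union> F) = (real (card W) - 1) / 2"
        using glue(3)[of "star_weight v"] wX F(2) U(4) by (simp add: field_simps)
    qed (use a bc in \<open>auto simp: U_def\<close>)
    moreover have XF: "incidence_vec ((?X \<union> ?X') \<union> F) \<in> L"
      "(?X \<union> ?X') \<inter> F = {}"
    proof -
      have d: "({v, a, b} \<union> {v, b, c}) \<inter> U = {}" using U by (auto simp: U_def)
      note glue = glue_at_vertex[OF XX _ _ F(1) U(1) d]
      show "incidence_vec ((?X \<union> ?X') \<union> F) \<in> L"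
      proof (rule tight)
        show "two_edge_connected (({v, a, b} \<union> {v, b, c}) \<union> U) ((?X \<union> ?X') \<union> F)"
          by (rule glue(1)) auto
        have "sum (star_weight v) ((?X \<union> ?X') \<union> F)
            = sum (star_weight v) (?X \<union> ?X') + sum (star_weight v) F"
          by (rule glue(3)) auto
        then show "sum (star_weight v) ((?X \<union> ?X') \<union> F) = (real (card W) - 1) / 2"
          using wXX F(2) U(4) by (simp add: field_simps)
      qed (use a bc in \<open>auto simp: U_def\<close>)
      show "(?X \<union> ?X') \<inter> F = {}"
        by (rule glue(2)) auto
    qed
    moreover have "incidence_vec ((?X \<union> ?X') \<union> F)
        = (incidence_vec {{v, c}} + incidence_vec {{b, c}}) + incidence_vec (?X \<union> F)"
    proof -
      have "(?X \<union> ?X') \<union> F = {{v, c}, {b, c}} \<union> (?X \<union> F)"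
        unfolding eq by (simp only: Un_ac)
      moreover have "{{v, c}, {b, c}} \<inter> F = {}"
        using XF(2) unfolding eq Int_Un_distrib2 Un_empty by (rule conjunct2)
      then have "{{v, c}, {b, c}} \<inter> (?X \<union> F) = {}"
        by (simp only: Int_Un_distrib trans[OF Int_commute disj] Un_empty_left)
      ultimately show ?thesis
        using incidence_vec_insert[OF new] by (metis incidence_vec_Un)
    qed
    ultimately show ?thesis
      using subspace_diff[OF L] by (metis add_diff_cancel_right')
  qed
  \<comment> \<open>Exchanging the roles of \<open>b\<close> and \<open>c\<close> in
    \<open>pair\<close> and subtracting cancels the edge between them.\<close>
  have star_diff: "incidence_vec {{v, b}} - incidence_vec {{v, c}} \<in> L" if "b \<in> W" "c \<in> W" for b c
  proof (cases "b = c")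
    case True
    then show ?thesis using subspace_0[OF L] by (metis diff_self)
  next
    case False
    have "(incidence_vec {{v, b}} + incidence_vec {{c, b}}) - (incidence_vec {{v, c}} + incidence_vec {{b, c}}) \<in> L"
      using that False by (intro subspace_diff[OF L] pair) auto
    then show ?thesis
      by (simp add: insert_commute)
  qed
  \<comment> \<open>The windmill on \<open>W - {c}\<close> is tight. Modulo \<open>L\<close> it is a
    nonzero multiple of the star edge \<open>{v, c}\<close>, since all star edges agree there, so
    that edge lies in \<open>L\<close> as well.\<close>
  have star: "incidence_vec {{v, c}} \<in> L" if c: "c \<in> W" for c
  proof -
    have "card (W - {c}) = card W - 1"
      using c W by simp
    then have U: "finite (W - {c})" "v \<notin> W - {c}" "even (card (W - {c}))"
      "real (card (W - {c})) = real (card W) - 1"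
      using W by auto
    then obtain F where F: "windmill v (W - {c}) F"
      using windmill_exists by blast
    then have "incidence_vec F \<in> L"
      using windmill_graph[OF F] U by (intro tight[of "insert v (W - {c})"]) auto
    moreover have "incidence_vec F - (real (card (W - {c})) / 2) *\<^sub>R incidence_vec {{v, c}} \<in> L"
      by (rule windmill_modulo_subspace[OF F L _ pair star_diff]) (use c in auto)
    ultimately have "incidence_vec F - (incidence_vec F
        - (real (card (W - {c})) / 2) *\<^sub>R incidence_vec {{v, c}}) \<in> L"
      by (rule subspace_diff[OF L])
    then have m: "(real (card (W - {c})) / 2) *\<^sub>R incidence_vec {{v, c}} \<in> L"
      by (metis diff_diff_eq2 add_diff_cancel_left')
    have "real (card (W - {c})) / 2 \<noteq> 0"
      using U W by simp
    then have "incidence_vec {{v, c}} = (1 / (real (card (W - {c})) / 2)) *\<^sub>R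
        ((real (card (W - {c})) / 2) *\<^sub>R incidence_vec {{v, c}})"
      by (simp only: scaleR_scaleR) simp
    then show ?thesis
      using subspace_scale[OF L m] by metis
  qed
  obtain x y where xy: "e = {x, y}" "x \<noteq> y"
    using e(2) by (auto simp: card_2_iff)
  consider "x = v" "y \<in> W" | "y = v" "x \<in> W" | "x \<in> W" "y \<in> W"
    using e(1) xy by auto
  then show ?thesis
  proof cases
    case 1
    then show ?thesis using star xy by simp
  next
    case 2
    then show ?thesis using star[of x] xy insert_commute[of x v] by simp
  next
    case 3
    have "(incidence_vec {{v, y}} + incidence_vec {{x, y}}) - incidence_vec {{v, y}} \<in> L"
      using 3 xy by (intro subspace_diff[OF L] pair star) auto
    then show ?thesis using xy by simp
  qed
qed

section \<open>The facet for even \<open>n\<close>\<close>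

lemma facet_even:
  assumes n: "n \<ge> 4" "even n" and v: "v < n"
  shows "defines_facet (TECSP n) (\<lambda>x. \<Sum>e\<in>Kn_edges n. star_weight v e * x e) ((real n - 2) / 2)"
proof (rule facet_criterion)
  show "(real n - 2) / 2 > 0" using n by simp
next
  fix V F assume V: "V \<subseteq> {..<n}" and F: "two_edge_connected V F"
  have finV: "finite V" using V finite_subset by blast
  have graph: "is_graph V F" using F by (simp add: two_edge_connected_def)
  note sum = sum_star_weight[OF graph is_graph_finite[OF graph finV], of v]
  note D = neighbours_subset[OF graph, of v]
  show "sum (star_weight v) F \<le> (real n - 2) / 2"
  proof (cases "v \<in> V")
    case True
    obtain r where r: "2 * r \<le> card (neighbours F v)" "card (V - {v}) \<le> r + card {e \<in> F. v \<notin> e}"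
      using two_edge_connected_count[OF F finV True] .
    have "card (neighbours F v) \<le> card (V - {v})"
      using D finV by (intro card_mono) auto
    moreover have "card (V - {v}) \<le> card ({..<n} - {v})"
      using V by (intro card_mono) auto
    moreover have "card ({..<n} - {v}) = n - 1"
      using v by simp
    \<comment> \<open>The count bounds the weight by \<open>r\<close>. Since \<open>n - 1\<close> is
      odd, \<open>2 * r \<le> n - 1\<close> sharpens to \<open>2 * r \<le> n - 2\<close>.\<close>
    ultimately have "2 * r + 2 \<le> n" "card (neighbours F v) \<le> r + card {e \<in> F. v \<notin> e}"
      using r n by presburger+
    then have "real (2 * r + 2) \<le> real n"
      "real (card (neighbours F v)) \<le> real (r + card {e \<in> F. v \<notin> e})"
      by (simp_all only: of_nat_le_iff)
    then show ?thesis
      unfolding sum by simp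
  next
    case False
    then have "neighbours F v = {}"
      using graph by (auto simp: neighbours_def dest: is_graph_doubletonD)
    then show ?thesis
      unfolding sum using n by simp
  qed
next
  fix e assume e: "e \<in> Kn_edges n"
  let ?W = "{..<n} - {v}"
  let ?S = "{incidence_vec F | V F. V \<subseteq> {..<n} \<and> F \<subseteq> Kn_edges n \<and> two_edge_connected V F
    \<and> sum (star_weight v) F = (real n - 2) / 2}"
  have W: "insert v ?W = {..<n}" "card ?W = n - 1"
    using v by auto
  show "incidence_vec {e} \<in> span ?S"
  proof (rule star_span[of _ ?W v])
    fix V F assume F: "two_edge_connected V F" "V \<subseteq> insert v ?W"
      "sum (star_weight v) F = (real (card ?W) - 1) / 2"
    then have "F \<subseteq> Kn_edges n"
      using W is_graph_subset_Kn_edges by (metis two_edge_connected_def)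
    moreover have "(real (card ?W) - 1) / 2 = (real n - 2) / 2"
      using W n by simp
    ultimately show "incidence_vec F \<in> span ?S"
      using F unfolding W(1)
      by (intro span_base CollectI exI[of _ V] exI[of _ F]) simp
  qed (use W n e in \<open>auto simp: Kn_edges_eq\<close>)
qed

section \<open>The facet for odd \<open>n\<close>\<close>

text \<open>Written as a correction of \<open>star_weight\<close>, so that its bounds carry over:
  the coefficient of \<open>{v, w1}\<close> drops from 1 to -1, that of \<open>{w1, w2}\<close>
  rises from -1 to 0.\<close>

definition odd_weight :: "nat \<Rightarrow> nat \<Rightarrow> nat \<Rightarrow> nat set \<Rightarrow> real" where
  "odd_weight v w1 w2 e = star_weight v e - 2 * of_bool (e = {v, w1}) + of_bool (e = {w1, w2})"

lemma sum_odd_weight: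
  assumes "finite F"
  shows "sum (odd_weight v w1 w2) F
    = sum (star_weight v) F - 2 * of_bool ({v, w1} \<in> F) + of_bool ({w1, w2} \<in> F)"
proof -
  have "(\<Sum>e\<in>F. of_bool (e = a)) = (of_bool (a \<in> F) :: real)" for a
  proof -
    have "(\<Sum>e\<in>F. of_bool (e = a)) = (\<Sum>e\<in>F. if e = a then 1 else (0 :: real))"
      by (intro sum.cong) auto
    then show ?thesis using assms by simp
  qed
  then show ?thesis
    by (simp add: odd_weight_def sum.distrib sum_subtractf flip: sum_distrib_left)
qed

lemma facet_odd:
  assumes n: "n \<ge> 4" "odd n" and v: "v < n" "w1 < n" "w2 < n"
    and ne: "w1 \<noteq> w2" "v \<noteq> w1" "v \<noteq> w2"
  shows "defines_facet (TECSP n) (\<lambda>x. \<Sum>e\<in>Kn_edges n. odd_weight v w1 w2 e * x e) ((real n - 3) / 2)"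
proof (rule facet_criterion)
  have n5: "n \<ge> 5" using n by presburger
  then show "(real n - 3) / 2 > 0" by simp
  let ?w = "odd_weight v w1 w2"
  let ?f = "{v, w1}" and ?h = "{w1, w2}"
  {
    fix V F assume V: "V \<subseteq> {..<n}" and F: "two_edge_connected V F"
    have finV: "finite V" using V finite_subset by blast
    have graph: "is_graph V F" using F by (simp add: two_edge_connected_def)
    have finF: "finite F" using is_graph_finite[OF graph finV] .
    note sum = sum_odd_weight[OF finF] sum_star_weight[OF graph finF]
    let ?D = "neighbours F v" and ?F = "{e \<in> F. v \<notin> e}"
    have D: "?D \<subseteq> V - {v}" using neighbours_subset[OF graph] .
    have hF: "?h \<in> F \<longleftrightarrow> ?h \<in> ?F" using ne by auto
    have "V - {v} \<subseteq> {..<n} - {v}" using V by blast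
    then have N: "card (V - {v}) \<le> n - 1"
      using card_mono[of "{..<n} - {v}" "V - {v}"] v by simp
    show "sum ?w F \<le> (real n - 3) / 2"
    proof (cases "v \<in> V")
      case False
      then have "?D = {}" "?f \<notin> F"
        using graph by (auto simp: neighbours_def dest: is_graph_doubletonD)
      \<comment> \<open>The bonus for \<open>h\<close> is offset by \<open>h\<close> itself being
        counted in \<open>?F\<close>, so the weight is at most 0.\<close>
      moreover have "of_bool (?h \<in> F) \<le> real (card ?F)"
      proof (cases "?h \<in> F")
        case True
        moreover have "finite ?F" using finF by simp
        ultimately have "card ?F \<noteq> 0"
          using hF by (metis card_0_eq empty_iff)
        then show ?thesis by simp
      qed simp
      ultimately show ?thesis
        unfolding sum using n5 by simp
    next
      case True
      obtain r where r: "2 * r \<le> card ?D" "card (V - {v}) \<le> r + card ?F"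
        using two_edge_connected_count[OF F finV True] .
      have DN: "card ?D \<le> card (V - {v})"
        using D finV by (intro card_mono) auto
      show ?thesis
      proof (cases "?f \<in> F")
        case True
        \<comment> \<open>The edge \<open>f\<close> costs 2 and \<open>h\<close> returns at most 1,
          so the weight is at most \<open>r - 1\<close>, and \<open>2 * r \<le> n - 1\<close> is
          enough.\<close>
        have "2 * r + 1 \<le> n" "card ?D \<le> r + card ?F" using r DN N n5 by linarith+
        then have "real (2 * r + 1) \<le> real n" "real (card ?D) \<le> real (r + card ?F)"
          by (simp_all only: of_nat_le_iff)
        then show ?thesis
          unfolding sum using True by (cases "?h \<in> F") simp_all
      next
        case False
        then have w1: "w1 \<notin> ?D" by (simp add: neighbours_def)
        then have "?D \<subseteq> {..<n} - {v, w1}" using D V by auto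
        then have "card ?D \<le> card ({..<n} - {v, w1})"
          by (intro card_mono) auto
        also have "\<dots> = n - 2"
          using v ne by (subst card_Diff_subset) auto
        \<comment> \<open>Without \<open>f\<close> the vertex \<open>v\<close> has at most
          \<open>n - 2\<close> neighbours. This number is odd, so
          \<open>2 * r \<le> n - 3\<close>.\<close>
        finally have "2 * r + 3 \<le> n"
          using r n by presburger
        \<comment> \<open>If \<open>h\<close> is present, then \<open>w1\<close> is a vertex of
          \<open>H - v\<close> that is not adjacent to \<open>v\<close>; this missing neighbour pays
          for the bonus of \<open>h\<close>.\<close>
        moreover have "card ?D + of_bool (?h \<in> F) \<le> card (V - {v})"
        proof (cases "?h \<in> F")
          case True
          then have "w1 \<in> V - {v}"
            using graph ne by (auto dest: is_graph_doubletonD)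
          then have "?D \<subset> V - {v}" using D w1 by blast
          then have "card ?D < card (V - {v})"
            using finV by (intro psubset_card_mono) auto
          then show ?thesis by simp
        qed (use DN in simp)
        ultimately have "real (2 * r + 3) \<le> real n"
          "real (card ?D + of_bool (?h \<in> F)) \<le> real (r + card ?F)"
          using r by (simp_all only: of_nat_le_iff)
        then show ?thesis
          unfolding sum using False by simp
      qed
    qed
  }
  fix e assume e: "e \<in> Kn_edges n"
  let ?S = "{incidence_vec F | V F. V \<subseteq> {..<n} \<and> F \<subseteq> Kn_edges n \<and> two_edge_connected V F
    \<and> sum ?w F = (real n - 3) / 2}"
  define L where "L = span ?S"
  have L: "subspace L" by (simp add: L_def)
  have tight: "incidence_vec F \<in> L"
    if "two_edge_connected V F" "V \<subseteq> {..<n}" "sum ?w F = (real n - 3) / 2" for V F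
  proof -
    have "F \<subseteq> Kn_edges n"
      using that is_graph_subset_Kn_edges by (metis two_edge_connected_def)
    then show ?thesis
      unfolding L_def using that by (intro span_base) blast
  qed
  have avoid: "sum ?w F = sum (star_weight v) F"
    if "two_edge_connected V F" "finite V" "w1 \<notin> V" for V F
  proof -
    have graph: "is_graph V F" using that by (simp add: two_edge_connected_def)
    then have "?f \<notin> F" "?h \<notin> F"
      using that(3) by (auto dest: is_graph_doubletonD)
    then show ?thesis
      using sum_odd_weight[OF is_graph_finite[OF graph that(2)]] by simp
  qed
  \<comment> \<open>Graphs avoiding \<open>w1\<close> have the same weight under both coefficient
    vectors, and with \<open>n - 2\<close> vertices besides \<open>v\<close> their tight value is
    \<open>(n - 3) / 2\<close>. All edges off \<open>w1\<close> are thus settled.\<close>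
  have known: "incidence_vec {e} \<in> L" if "e \<subseteq> {..<n}" "w1 \<notin> e" "card e = 2" for e
  proof -
    let ?W = "{..<n} - {v, w1}"
    have "card ?W = n - 2"
      using v ne by (subst card_Diff_subset) auto
    moreover have "insert v ?W = {..<n} - {w1}"
      using v ne by auto
    ultimately have W: "card ?W = n - 2" "insert v ?W = {..<n} - {w1}" .
    show ?thesis
    proof (rule star_span[of L ?W v, OF L])
      fix V F assume F: "two_edge_connected V F" "V \<subseteq> insert v ?W"
        "sum (star_weight v) F = (real (card ?W) - 1) / 2"
      then have "V \<subseteq> {..<n}" "w1 \<notin> V" using W(2) by auto
      moreover from this have "finite V" using finite_subset by blast
      moreover have "(real (card ?W) - 1) / 2 = (real n - 3) / 2"
        using W n5 by simp
      ultimately show "incidence_vec F \<in> L"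
        using F avoid[OF F(1)] by (intro tight[OF F(1)]) simp_all
    qed (use W n5 n that in auto)
  qed
  \<comment> \<open>A block \<open>X\<close> through \<open>v\<close> and \<open>w1\<close> is
    completed to a tight graph by a windmill on \<open>U\<close>. All edges off \<open>w1\<close>
    are known, so \<open>Z\<close> only has to retain the edges of \<open>X\<close> at
    \<open>w1\<close>.\<close>
  have block: "incidence_vec Z \<in> L"
    if Y: "two_edge_connected Y X" "Y \<subseteq> {..<n}" "v \<in> Y" "w1 \<in> Y"
      and U: "U \<subseteq> {..<n} - Y" "even (card U)" "sum ?w X + real (card U) / 2 = (real n - 3) / 2"
      and Z: "Z \<subseteq> X" "\<And>e. e \<in> X - Z \<Longrightarrow> w1 \<notin> e" for Y X U Z
  proof -
    have finU: "finite U" and finY: "finite Y"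
      using U(1) Y(2) finite_subset by blast+
    have UY: "v \<notin> U" "w1 \<notin> U" "Y \<inter> U = {}"
      using U(1) Y(3,4) by auto
    obtain F where "windmill v U F"
      using windmill_exists[OF finU UY(1) U(2)] by blast
    then have F: "two_edge_connected (insert v U) F" "sum (star_weight v) F = real (card U) / 2"
      using windmill_graph by blast+
    then have wF: "sum ?w F = real (card U) / 2"
      using avoid[OF F(1)] finU UY ne by simp
    note glue = glue_at_vertex[OF Y(1) finY Y(3) F(1) finU UY(3)]
    have YU: "Y \<union> U \<subseteq> {..<n}" using Y U by blast
    have "is_graph (Y \<union> U) (X \<union> F)"
      using glue(1) by (simp add: two_edge_connected_def)
    then have finite: "finite (X \<union> F)"
      using is_graph_finite finY finU by blast
    have graph: "card e = 2 \<and> e \<subseteq> {..<n}" if "e \<in> X \<union> F" for e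
      using \<open>is_graph (Y \<union> U) (X \<union> F)\<close> that YU unfolding is_graph_iff by (meson order_trans)
    have "w1 \<notin> e" if "e \<in> F" for e
      using F(1) that UY ne unfolding two_edge_connected_def is_graph_iff by blast
    then have rest: "incidence_vec {e} \<in> L" if "e \<in> (X \<union> F) - Z" for e
      using that graph[of e] Z(2) by (intro known) auto
    have "sum ?w (X \<union> F) = (real n - 3) / 2"
      using glue(3)[of ?w] wF U(3) by simp
    from tight[OF glue(1) YU this] show ?thesis
      by (rule incidence_vec_subset_in_subspace[OF L _ finite]) (use Z(1) rest in auto)
  qed
  note ne' = ne ne[symmetric]
  \<comment> \<open>The triangle has weight \<open>-1 + 1 + 0 = 0\<close>, and the windmill on the
    other \<open>n - 3\<close> vertices supplies the whole right-hand side.\<close>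
  have fh: "incidence_vec {?f, ?h} \<in> L"
  proof (rule block[of "{v, w1, w2}" "{{v, w1}, {v, w2}, {w1, w2}}" "{..<n} - {v, w1, w2}"])
    have c: "card ({..<n} - {v, w1, w2}) = n - 3"
      using v ne by (subst card_Diff_subset) auto
    then show "even (card ({..<n} - {v, w1, w2}))"
      using n by simp
    show "sum ?w {{v, w1}, {v, w2}, {w1, w2}} + real (card ({..<n} - {v, w1, w2})) / 2 = (real n - 3) / 2"
      unfolding c using ne n5 by (simp add: sum_odd_weight sum_star_weight_triangle)
  qed (use v ne in \<open>auto intro: two_edge_connected_triangle\<close>)
  have step: "incidence_vec {?h, {w1, x}} \<in> L" "incidence_vec {{w1, y}} \<in> L"
    if x: "x < n" "x \<notin> {v, w1, w2}" and y: "y < n" "y \<notin> {v, w1, w2, x}" for x y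
  proof -
    have d: "v \<noteq> x" "w1 \<noteq> x" "w2 \<noteq> x" "v \<noteq> y" "w1 \<noteq> y" "w2 \<noteq> y" "x \<noteq> y"
      using x y by auto
    note d' = d d[symmetric] ne'
    let ?U = "{..<n} - {v, w1, w2, x, y}"
    have c: "card ?U = n - 5"
      using x y v ne by (subst card_Diff_subset) (auto simp: numeral_eq_Suc)
    have U: "even (card ?U)" "real (card ?U) / 2 = (real n - 5) / 2"
      unfolding c using n n5 by auto
    \<comment> \<open>The 4-cycle has weight \<open>1 + 1 + 0 - 1 = 1\<close>. Adding
      \<open>{v, y}\<close> and \<open>{w1, y}\<close> keeps the weight at 1, so the windmill on the
      remaining \<open>n - 5\<close> vertices makes both blocks tight. Their difference isolates
      \<open>{w1, y}\<close>, as \<open>{v, y}\<close> is known.\<close>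
    let ?Q = "\<lambda>x. {{v, w2}, {v, x}, {w1, w2}, {w1, x}}"
    have Qx: "two_edge_connected {v, w2, x, w1} (?Q x)" and Qy: "two_edge_connected {v, w2, y, w1} (?Q y)"
      using d' by (auto intro: two_edge_connected_square)
    have wQ: "sum ?w (?Q x) = 1"
      by (simp add: odd_weight_def star_weight_def doubleton_eq_iff d')
    have E: "?Q x \<union> ?Q y = {{v, w2}, {v, x}, {v, y}, {w1, w2}, {w1, x}, {w1, y}}"
      by auto
    have wE: "sum ?w (?Q x \<union> ?Q y) = 1"
      unfolding E by (simp add: odd_weight_def star_weight_def doubleton_eq_iff d')
    show hx: "incidence_vec {?h, {w1, x}} \<in> L"
      by (rule block[OF Qx _ _ _ _ U(1)]) (use v x U wQ in \<open>auto simp: d' field_simps\<close>)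
    have "incidence_vec {?h, {w1, x}, {w1, y}} \<in> L"
      by (rule block[OF two_edge_connected_Un[OF Qx Qy, of v] _ _ _ _ U(1)])
        (use v x y U wE in \<open>auto simp: d' field_simps\<close>)
    then have "incidence_vec ({?h, {w1, x}} \<union> {{w1, y}}) \<in> L"
      by (simp add: insert_commute)
    moreover have "incidence_vec ({?h, {w1, x}} \<union> {{w1, y}})
        = incidence_vec {?h, {w1, x}} + incidence_vec {{w1, y}}"
      by (rule incidence_vec_Un) (auto simp: doubleton_eq_iff d')
    ultimately show "incidence_vec {{w1, y}} \<in> L"
      using subspace_diff[OF L _ hx] by (metis add_diff_cancel_left')
  qed
  have other: "\<exists>x<n. x \<notin> {v, w1, w2, y}" for y
  proof -
    have "\<not> {..<n} \<subseteq> {v, w1, w2, y}"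
      using n5 card_mono[of "{v, w1, w2, y}" "{..<n}"] card_insert_le_m1[of 4 "{w1, w2, y}" v]
        card_insert_le_m1[of 3 "{w2, y}" w1] card_insert_le_m1[of 2 "{y}" w2] by auto
    then show ?thesis by auto
  qed
  have w1y: "incidence_vec {{w1, y}} \<in> L" if "y < n" "y \<notin> {v, w1, w2}" for y
  proof -
    obtain x where "x < n" "x \<notin> {v, w1, w2, y}" using other by blast
    then show ?thesis using step(2)[of x y] that by auto
  qed
  \<comment> \<open>Once the edges \<open>{w1, x}\<close> are available, the relation from one
    4-cycle yields \<open>h\<close>; the relation from the triangle then yields
    \<open>f\<close>.\<close>
  have h: "incidence_vec {?h} \<in> L"
  proof -
    obtain x where x: "x < n" "x \<notin> {v, w1, w2}" using other[of v] by auto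
    obtain y where y: "y < n" "y \<notin> {v, w1, w2, x}" using other[of x] by auto
    show ?thesis
      by (rule incidence_vec_subset_in_subspace[OF L step(1)[OF x y]])
        (use w1y[OF x] in auto)
  qed
  have f: "incidence_vec {?f} \<in> L"
    by (rule incidence_vec_subset_in_subspace[OF L fh]) (use h in auto)
  have "incidence_vec {e} \<in> L"
  proof (cases "w1 \<in> e")
    case False
    then show ?thesis using e by (intro known) (auto simp: Kn_edges_eq)
  next
    case True
    then obtain z where z: "e = {w1, z}" "z \<noteq> w1" "z < n"
      using e unfolding Kn_edges_def by auto
    show ?thesis
      using f h w1y[of z] z by (cases "z = v"; cases "z = w2") (auto simp: insert_commute)
  qed
  then show "incidence_vec {e} \<in> span ?S"
    by (simp add: L_def)
qed

section \<open>The coefficient vectors written as differences of edge sums\<close>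

lemma weighted_sum_star_weight:
  "(\<Sum>e\<in>Kn_edges n. star_weight v e * x e)
    = xsum x {e \<in> Kn_edges n. v \<in> e} - xsum x {e \<in> Kn_edges n. v \<notin> e}"
proof -
  have "(\<Sum>e\<in>Kn_edges n. star_weight v e * x e) = (\<Sum>e\<in>Kn_edges n. if v \<in> e then x e else - x e)"
    by (intro sum.cong) (auto simp: star_weight_def)
  then show ?thesis
    unfolding sum.If_cases[OF finite_Kn_edges] by (simp add: Int_def sum_negf xsum_def)
qed

lemma weighted_sum_odd_weight:
  assumes "v < n" "w1 < n" "w2 < n" "w1 \<noteq> w2" "v \<noteq> w1" "v \<noteq> w2"
  shows "(\<Sum>e\<in>Kn_edges n. odd_weight v w1 w2 e * x e)
    = xsum x ({e \<in> Kn_edges n. v \<in> e} - {{v, w1}})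
      - xsum x ({e \<in> Kn_edges n. v \<notin> e} - {{w1, w2}}) - x {v, w1}"
proof -
  have edges: "{v, w1} \<in> Kn_edges n" "{w1, w2} \<in> Kn_edges n"
    using assms by (auto simp: Kn_edges_eq)
  have unit: "(\<Sum>e\<in>Kn_edges n. of_bool (e = a) * x e) = x a" if "a \<in> Kn_edges n" for a
  proof -
    have "(\<Sum>e\<in>Kn_edges n. of_bool (e = a) * x e) = (\<Sum>e\<in>Kn_edges n. if e = a then x e else 0)"
      by (intro sum.cong) auto
    then show ?thesis using that finite_Kn_edges by simp
  qed
  have "(\<Sum>e\<in>Kn_edges n. odd_weight v w1 w2 e * x e)
      = (\<Sum>e\<in>Kn_edges n. star_weight v e * x e - 2 * (of_bool (e = {v, w1}) * x e)
          + of_bool (e = {w1, w2}) * x e)"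
    by (intro sum.cong) (auto simp: odd_weight_def algebra_simps)
  also have "\<dots> = (\<Sum>e\<in>Kn_edges n. star_weight v e * x e) - 2 * x {v, w1} + x {w1, w2}"
    using edges by (simp only: sum.distrib sum_subtractf sum_distrib_left[symmetric] unit)
  finally show ?thesis
    using edges assms finite_Kn_edges[of n] by (simp add: weighted_sum_star_weight xsum_def sum_diff1)
qed

theorem mainTheorem11:
  fixes n :: nat
  assumes "n \<ge> 4"
  shows "(even n \<longrightarrow> (\<forall>v < n.
            defines_facet (TECSP n)
              (\<lambda>x. xsum x {e \<in> Kn_edges n. v \<in> e} - xsum x {e \<in> Kn_edges n. v \<notin> e})
              ((real n - 2) / 2)))
       \<and> (odd n \<longrightarrow> (\<forall>v w1 w2. v < n \<and> w1 < n \<and> w2 < n \<and> w1 \<noteq> w2 \<and> v \<noteq> w1 \<and> v \<noteq> w2 \<longrightarrow>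
            defines_facet (TECSP n)
              (\<lambda>x. xsum x ({e \<in> Kn_edges n. v \<in> e} - {{v, w1}})
                   - xsum x ({e \<in> Kn_edges n. v \<notin> e} - {{w1, w2}})
                   - x {v, w1})
              ((real n - 3) / 2)))"
  using facet_even[OF assms] facet_odd[OF assms]
  by (simp add: weighted_sum_star_weight weighted_sum_odd_weight)

end
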